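(* Let $n\ge1$, $x=(x_1,\ldots,x_n)$, and let $u$ be an indeterminate. For any $\alpha\in\mathbb N^n$, one has $$\sum_{\beta\le\alpha}(-1)^{|\beta|}q^{\binom{|\beta|}{2}}\,C_{\alpha,\beta}(x;q)\,u^{|\beta|}=(u)_{|\alpha|}.$$
   Context: $q$ is an indeterminate, $x_1,\ldots,x_n$ are variables, $\mathbb N=\{0,1,2,\ldots\}$. For multi-indices $\alpha,\beta\in\mathbb N^n$: $|\alpha|=\alpha_1+\cdots+\alpha_n$, and $\beta\le\alpha$ means $\beta_i\le\alpha_i$ for all $i$; the sum is over $\beta\in\mathbb N^n$ with $\beta\le\alpha$. $(a)_k=(a;q)_k=(1-a)(1-aq)\cdots(1-aq^{k-1})$. For $\beta\le\alpha$, $$C_{\alpha,\beta}(x;q)=\prod_{1\le i,j\le n}\frac{(q^{\alpha_i-\beta_j+1}x_i/x_j)_{\beta_j}}{(q^{\beta_i-\beta_j+1}x_i/x_j)_{\beta_j}}.$$ *)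

theory Defs
  imports
    Main
    "HOL-Library.FuncSet"
    "HOL-Library.Poly_Mapping"
    "HOL-Computational_Algebra.Fraction_Field"
begin

text \<open>
  Rational functions over a field \<open>'a\<close> in countably many indeterminates \<open>indet 0, indet 1, \<dots>\<close>:
  the fraction field of the polynomial ring, a polynomial being a finitely supported map from
  monomials (finitely supported exponent vectors) to coefficients.
\<close>

type_synonym 'a ratfun = "((nat \<Rightarrow>\<^sub>0 nat) \<Rightarrow>\<^sub>0 'a) fract"

definition indet :: "nat \<Rightarrow> 'a::field ratfun" where
  "indet v = Fract (Poly_Mapping.single (Poly_Mapping.single v 1) 1) 1"

text \<open>The indeterminates are named so that \<open>q\<close>, \<open>u\<close> and all the \<open>x\<^sub>i\<close> are pairwise distinct.\<close>

definition q_var :: "'a::field ratfun" where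
  "q_var = indet 0"

definition u_var :: "'a::field ratfun" where
  "u_var = indet 1"

definition x_var :: "nat \<Rightarrow> 'a::field ratfun" where
  "x_var i = indet (i + 2)"

definition qpoch :: "'b::field \<Rightarrow> 'b \<Rightarrow> nat \<Rightarrow> 'b" where
  "qpoch a q k = (\<Prod>m<k. 1 - a * q ^ m)"

text \<open>
  A multi-index is a function on \<open>{1..n}\<close>; extensionality (value \<^const>\<open>undefined\<close> outside
  \<open>{1..n}\<close>) makes the representation unique, so that sums over multi-indices count each one once.
\<close>

definition multi_index :: "nat \<Rightarrow> (nat \<Rightarrow> nat) set" where
  "multi_index n = ({1..n} \<rightarrow>\<^sub>E UNIV)"

definition mi_le :: "nat \<Rightarrow> (nat \<Rightarrow> nat) \<Rightarrow> (nat \<Rightarrow> nat) \<Rightarrow> bool" where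
  "mi_le n \<beta> \<alpha> \<longleftrightarrow> (\<forall>i\<in>{1..n}. \<beta> i \<le> \<alpha> i)"

definition mi_abs :: "nat \<Rightarrow> (nat \<Rightarrow> nat) \<Rightarrow> nat" where
  "mi_abs n \<alpha> = (\<Sum>i\<in>{1..n}. \<alpha> i)"

text \<open>The exponents of \<open>q\<close> can be negative, hence the integer powers.\<close>

definition C_coeff ::
  "nat \<Rightarrow> (nat \<Rightarrow> nat) \<Rightarrow> (nat \<Rightarrow> nat) \<Rightarrow> (nat \<Rightarrow> 'b::field) \<Rightarrow> 'b \<Rightarrow> 'b" where
  "C_coeff n \<alpha> \<beta> x q =
    (\<Prod>i\<in>{1..n}. \<Prod>j\<in>{1..n}.
      qpoch (q powi (int (\<alpha> i) - int (\<beta> j) + 1) * x i / x j) q (\<beta> j) /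
      qpoch (q powi (int (\<beta> i) - int (\<beta> j) + 1) * x i / x j) q (\<beta> j))"

end

theory Submission
  imports Defs
begin

text \<open>
  Collecting the multi-indices of equal size reduces the identity to the terminating
  \<open>q\<close>-binomial theorem, once it is known that the sum of the \<open>C\<^sub>\<alpha>\<^sub>,\<^sub>\<beta>\<close> over \<open>|\<beta>| = k\<close>
  is the \<open>q\<close>-binomial coefficient of \<open>|\<alpha>|\<close> over \<open>k\<close>; in particular it does not depend on \<open>x\<close>.

  For that sum, write \<open>A\<^sub>i = q\<^bsup>\<alpha>\<^sub>i\<^esup> x\<^sub>i\<close> and \<open>B\<^sub>i = q\<^bsup>\<beta>\<^sub>i\<^esup> x\<^sub>i\<close>.  Reversing the Pochhammer
  products shows that \<open>C\<^sub>\<alpha>\<^sub>,\<^sub>\<beta>\<close> is the product of the values of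
  \<open>\<rho>(z) = (\<Prod>i. (z - A\<^sub>i) / (z - B\<^sub>i))\<close> at all points \<open>z = q\<^sup>m x\<^sub>j\<close> with \<open>m < \<beta>\<^sub>j\<close>.  In this
  form \<open>\<alpha>\<close> enters only through \<open>A\<close>, and \<open>A\<close> may be arbitrary.  Two facts then suffice.

  The first is a partial fraction expansion (\<open>sum_residue_weight\<close>): the weights
  \<open>f\<^sub>j(A, x) = (\<Prod>i. x\<^sub>j - A\<^sub>i) / (x\<^sub>j (\<Prod>i\<noteq>j. x\<^sub>j - x\<^sub>i))\<close> add up to \<open>1 - (\<Prod>A) / (\<Prod>x)\<close>.

  The second is that the substitution of \<open>q x\<^sub>j\<close> for \<open>x\<^sub>j\<close> together with the decrease of \<open>\<beta>\<^sub>j\<close> by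
  one leaves \<open>A\<close> and \<open>B\<close> alone and removes from the product just the point \<open>z = x\<^sub>j\<close>.  The removed
  factor \<open>\<rho>(x\<^sub>j)\<close> is \<open>f\<^sub>j(A, x) / f\<^sub>j(B, x)\<close> (\<open>residue_weight_shift\<close>).

  Since \<open>(\<Prod>B) / (\<Prod>x) = q\<^bsup>|\<beta>|\<^esup>\<close>, summing over \<open>j\<close> and over \<open>|\<beta>| = k + 1\<close> turns the second
  fact into a recursion: \<open>1 - q\<^bsup>k+1\<^esup>\<close> times the sum for \<open>k + 1\<close> is the sum over \<open>j\<close> of
  \<open>f\<^sub>j(A, x)\<close> times the sum for \<open>k\<close> at the shifted point.  By induction the latter does not
  depend on \<open>j\<close>, and the first fact finishes the evaluation (\<open>sum_shift_product\<close>).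
\<close>

section \<open>The terminating \<open>q\<close>-binomial theorem\<close>

text \<open>
  For \<open>Q = q\<^sup>N\<close> this is the \<open>q\<close>-binomial coefficient of \<open>N\<close> over \<open>k\<close>; a free \<open>Q\<close> is what the
  multivariate evaluation below produces.
\<close>
definition qbinom :: "'b::field \<Rightarrow> 'b \<Rightarrow> nat \<Rightarrow> 'b" where
  "qbinom q Q k = (\<Prod>m<k. (1 - Q / q ^ m) / (1 - q ^ Suc m))"

lemma qbinom_0 [simp]: "qbinom q Q 0 = 1"
  by (simp add: qbinom_def)

lemma qbinom_absorption:
  assumes "q \<noteq> 0" and "\<And>k. q ^ Suc k \<noteq> 1"
  shows "(1 - q ^ Suc k) * qbinom q Q (Suc k) = (1 - Q) * qbinom q (Q / q) k"
proof -
  have nz: "1 - q ^ Suc k \<noteq> 0" for k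
    using assms(2)[of k] by simp
  have "qbinom q Q (Suc k) = (\<Prod>m<Suc k. 1 - Q / q ^ m) / (\<Prod>m<Suc k. 1 - q ^ Suc m)"
    unfolding qbinom_def by (rule prod_dividef)
  also have "(\<Prod>m<Suc k. 1 - Q / q ^ m) = (1 - Q) * (\<Prod>m<k. 1 - Q / q / q ^ m)"
    unfolding prod.lessThan_Suc_shift by (simp add: field_simps)
  also have "(\<Prod>m<Suc k. 1 - q ^ Suc m) = (1 - q ^ Suc k) * (\<Prod>m<k. 1 - q ^ Suc m)"
    by simp
  finally have "qbinom q Q (Suc k) =
      ((1 - Q) * (\<Prod>m<k. 1 - Q / q / q ^ m)) / ((1 - q ^ Suc k) * (\<Prod>m<k. 1 - q ^ Suc m))" .
  then have "(1 - q ^ Suc k) * qbinom q Q (Suc k) =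
      (1 - Q) * ((\<Prod>m<k. 1 - Q / q / q ^ m) / (\<Prod>m<k. 1 - q ^ Suc m))"
    using nz[of k] by simp
  also have "(\<Prod>m<k. 1 - Q / q / q ^ m) / (\<Prod>m<k. 1 - q ^ Suc m) = qbinom q (Q / q) k"
    unfolding qbinom_def by (rule prod_dividef[symmetric])
  finally show ?thesis .
qed

text \<open>
  Both \<open>qbinom q (q * Q) (Suc k)\<close> and \<open>qbinom q Q (Suc k)\<close> are explicit multiples of
  \<open>qbinom q Q k\<close>: the first gains a factor at the front, the second one at the end.
\<close>
lemma qbinom_Pascal:
  assumes "q \<noteq> 0" and "\<And>k. q ^ Suc k \<noteq> 1"
  shows "qbinom q (q * Q) (Suc k) = q ^ Suc k * qbinom q Q (Suc k) + qbinom q Q k"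
proof -
  have nz: "1 - q ^ Suc k \<noteq> 0"
    using assms(2)[of k] by simp
  have last: "(1 - q ^ Suc k) * qbinom q Q (Suc k) = (1 - Q / q ^ k) * qbinom q Q k"
    using nz by (simp add: qbinom_def)
  have "(1 - q ^ Suc k) * (q ^ Suc k * qbinom q Q (Suc k) + qbinom q Q k)
      = q ^ Suc k * ((1 - q ^ Suc k) * qbinom q Q (Suc k)) + (1 - q ^ Suc k) * qbinom q Q k"
    by (simp only: algebra_simps)
  also have "\<dots> = (q ^ Suc k * (1 - Q / q ^ k) + (1 - q ^ Suc k)) * qbinom q Q k"
    unfolding last by (simp only: algebra_simps)
  also have "q ^ Suc k * (1 - Q / q ^ k) + (1 - q ^ Suc k) = 1 - q * Q"
    using assms(1) by (simp add: field_simps)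
  also have "\<dots> * qbinom q Q k = (1 - q ^ Suc k) * qbinom q (q * Q) (Suc k)"
    using qbinom_absorption[OF assms, of k "q * Q"] assms(1) by simp
  finally show ?thesis
    using nz by (metis mult_left_cancel)
qed

lemma qbinom_eq_0:
  assumes "q \<noteq> 0" and "N < k"
  shows "qbinom q (q ^ N) k = 0"
  unfolding qbinom_def using assms by (intro prod_zero) (auto intro!: bexI[of _ N])

lemma qpoch_Suc_shift: "qpoch a q (Suc N) = (1 - a) * qpoch (a * q) q N"
  unfolding qpoch_def prod.lessThan_Suc_shift by (simp add: mult.assoc)

text \<open>
  Pascal's rule matches the factorisation \<open>(u)\<^bsub>N+1\<^esub> = (1 - u) (q u)\<^bsub>N\<^esub>\<close>, so the induction
  hypothesis is used at \<open>q u\<close>.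
\<close>
lemma q_binomial_theorem:
  fixes q u :: "'b::field"
  assumes "q \<noteq> 0" and "\<And>k. q ^ Suc k \<noteq> 1"
  shows "(\<Sum>k\<le>N. (- 1) ^ k * q ^ (k choose 2) * qbinom q (q ^ N) k * u ^ k) = qpoch u q N"
proof (induction N arbitrary: u)
  case 0
  show ?case by (simp add: qpoch_def binomial_eq_0)
next
  case (Suc N)
  define t where "t k v = (- 1) ^ k * q ^ (k choose 2) * qbinom q (q ^ N) k * v ^ k" for k v
  have choose: "Suc k choose 2 = k + (k choose 2)" for k
    by (simp add: numeral_2_eq_2)
  have step: "(- 1) ^ Suc k * q ^ (Suc k choose 2) * qbinom q (q ^ Suc N) (Suc k) * u ^ Suc k
      = t (Suc k) (u * q) - u * t k (u * q)" for k
    unfolding t_def choose power_Suc[of q N] qbinom_Pascal[OF assms]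
    by (simp add: algebra_simps power_add power_mult_distrib)
  have "(\<Sum>k\<le>Suc N. (- 1) ^ k * q ^ (k choose 2) * qbinom q (q ^ Suc N) k * u ^ k)
      = 1 + (\<Sum>k\<le>N. t (Suc k) (u * q) - u * t k (u * q))"
    unfolding sum.atMost_Suc_shift step by (simp add: binomial_eq_0)
  also have "\<dots> = (\<Sum>k\<le>Suc N. t k (u * q)) - u * (\<Sum>k\<le>N. t k (u * q))"
    unfolding sum.atMost_Suc_shift[of "\<lambda>k. t k (u * q)"] sum_subtractf sum_distrib_left
    by (simp add: t_def binomial_eq_0)
  also have "(\<Sum>k\<le>Suc N. t k (u * q)) = (\<Sum>k\<le>N. t k (u * q))"
    using qbinom_eq_0[OF assms(1), of N "Suc N"] by (simp add: t_def)
  also have "(\<Sum>k\<le>N. t k (u * q)) = qpoch (u * q) q N"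
    unfolding t_def by (rule Suc.IH)
  finally show ?case
    by (simp add: qpoch_Suc_shift algebra_simps)
qed

section \<open>Partial fractions\<close>

text \<open>
  Induction on the set of poles: multiplying the expansion by one more factor
  \<open>(y - a) / (y - c)\<close> splits every summand into a pole at \<open>x\<^sub>j\<close> and one at \<open>c\<close>.  The contributions
  at \<open>c\<close> add up to the expected residue by the induction hypothesis at \<open>y = c\<close>.
\<close>
lemma prod_partial_fractions:
  fixes A x :: "'i \<Rightarrow> 'b::field"
  assumes "finite I" and "inj_on x I" and "y \<notin> x ` I"
  shows "(\<Prod>i\<in>I. (y - A i) / (y - x i))
    = 1 + (\<Sum>j\<in>I. (\<Prod>i\<in>I. x j - A i) / (\<Prod>i\<in>I - {j}. x j - x i) / (y - x j))"
  using assms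
proof (induction I arbitrary: y rule: finite_induct)
  case empty
  then show ?case by simp
next
  case (insert c I)
  define r where "r j = (\<Prod>i\<in>I. x j - A i) / (\<Prod>i\<in>I - {j}. x j - x i)" for j
  have inj: "inj_on x I" and c: "x c \<notin> x ` I" and y: "y \<notin> x ` I" "y \<noteq> x c"
    using insert.prems insert.hyps by auto
  note IH = insert.IH[OF inj, folded r_def]
  have resc: "(\<Prod>i\<in>insert c I. x c - A i) / (\<Prod>i\<in>insert c I - {c}. x c - x i)
      = (x c - A c) * (1 + (\<Sum>j\<in>I. r j / (x c - x j)))"
  proof -
    have "insert c I - {c} = I"
      using insert.hyps by auto
    then show ?thesis
      unfolding IH[OF c, symmetric] using insert.hyps by (simp add: prod_dividef)
  qed
  have resj: "(\<Prod>i\<in>insert c I. x j - A i) / (\<Prod>i\<in>insert c I - {j}. x j - x i)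
      = r j * ((x j - A c) / (x j - x c))" if "j \<in> I" for j
  proof -
    have "insert c I - {j} = insert c (I - {j})"
      using insert.hyps that by auto
    then show ?thesis
      using insert.hyps by (simp add: r_def mult.commute)
  qed
  have split: "(y - A c) / (y - x c) * (r j / (y - x j))
      = (x c - A c) / (y - x c) * (r j / (x c - x j))
        + r j * ((x j - A c) / (x j - x c)) / (y - x j)" if "j \<in> I" for j
  proof -
    have nz: "y - x c \<noteq> 0" "y - x j \<noteq> 0" "x c - x j \<noteq> 0"
      using c y that by auto
    have flip: "(x j - A c) / (x j - x c) = - (x j - A c) / (x c - x j)"
      by (metis minus_diff_eq minus_divide_right minus_divide_left)
    show ?thesis
      unfolding flip using nz by (simp add: divide_simps) (simp add: algebra_simps)
  qed
  have "(\<Prod>i\<in>insert c I. (y - A i) / (y - x i))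
      = (y - A c) / (y - x c) * (1 + (\<Sum>j\<in>I. r j / (y - x j)))"
    using insert.hyps IH[OF y(1)] by simp
  also have "\<dots> = (y - A c) / (y - x c) + (\<Sum>j\<in>I. (y - A c) / (y - x c) * (r j / (y - x j)))"
    by (simp add: distrib_left sum_distrib_left)
  also have "(\<Sum>j\<in>I. (y - A c) / (y - x c) * (r j / (y - x j)))
      = (x c - A c) / (y - x c) * (\<Sum>j\<in>I. r j / (x c - x j))
        + (\<Sum>j\<in>I. r j * ((x j - A c) / (x j - x c)) / (y - x j))"
    by (simp only: split sum.distrib sum_distrib_left cong: sum.cong)
  also have "(y - A c) / (y - x c) = 1 + (x c - A c) / (y - x c)"
    using y by (simp add: field_simps)
  finally have "(\<Prod>i\<in>insert c I. (y - A i) / (y - x i))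
      = 1 + ((x c - A c) * (1 + (\<Sum>j\<in>I. r j / (x c - x j))) / (y - x c)
        + (\<Sum>j\<in>I. r j * ((x j - A c) / (x j - x c)) / (y - x j)))"
    by (simp add: distrib_left add_divide_distrib)
  then show ?case
    unfolding sum.insert[OF insert.hyps(1,2)] resc
    by (simp only: resj cong: sum.cong)
qed

definition residue_weight :: "'i set \<Rightarrow> ('i \<Rightarrow> 'b::field) \<Rightarrow> ('i \<Rightarrow> 'b) \<Rightarrow> 'i \<Rightarrow> 'b" where
  "residue_weight I A x j = (\<Prod>i\<in>I. x j - A i) / (x j * (\<Prod>i\<in>I - {j}. x j - x i))"

text \<open>This is the partial fraction expansion at \<open>y = 0\<close>.\<close>
lemma sum_residue_weight:
  fixes A x :: "'i \<Rightarrow> 'b::field"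
  assumes "finite I" and "inj_on x I" and "\<And>i. i \<in> I \<Longrightarrow> x i \<noteq> 0"
  shows "(\<Sum>j\<in>I. residue_weight I A x j) = 1 - prod A I / prod x I"
proof -
  have "prod A I / prod x I = (\<Prod>i\<in>I. (0 - A i) / (0 - x i))"
    by (simp add: prod_dividef)
  also have "\<dots> = 1 + (\<Sum>j\<in>I. (\<Prod>i\<in>I. x j - A i) / (\<Prod>i\<in>I - {j}. x j - x i) / (0 - x j))"
    using assms by (intro prod_partial_fractions) auto
  also have "\<dots> = 1 + (\<Sum>j\<in>I. - residue_weight I A x j)"
    by (simp add: residue_weight_def mult.commute)
  finally show ?thesis
    by (simp add: sum_negf)
qed

section \<open>The sum over multi-indices of fixed size\<close>

text \<open>
  The inequalities exclude every zero denominator below; with two independent exponents the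
  condition is visibly stable under the shifts of \<open>x\<close> that the recursion makes.
\<close>
definition q_generic :: "'b::field \<Rightarrow> 'i set \<Rightarrow> ('i \<Rightarrow> 'b) \<Rightarrow> bool" where
  "q_generic q I x \<longleftrightarrow> q \<noteq> 0 \<and> (\<forall>k. q ^ Suc k \<noteq> 1) \<and> (\<forall>i\<in>I. x i \<noteq> 0)
    \<and> (\<forall>i\<in>I. \<forall>j\<in>I. i \<noteq> j \<longrightarrow> (\<forall>a b. q ^ a * x i \<noteq> q ^ b * x j))"

lemma q_genericD:
  assumes "q_generic q I x"
  shows "q \<noteq> 0" and "\<And>k. q ^ Suc k \<noteq> 1" and "\<And>i. i \<in> I \<Longrightarrow> x i \<noteq> 0"
    and "\<And>i j a b. i \<in> I \<Longrightarrow> j \<in> I \<Longrightarrow> i \<noteq> j \<Longrightarrow> q ^ a * x i \<noteq> q ^ b * x j"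
  using assms by (auto simp: q_generic_def)

lemma q_generic_inj_on: "q_generic q I x \<Longrightarrow> inj_on x I"
  using q_genericD(4)[of q I x _ _ 0 0] by (auto simp: inj_on_def)

lemma q_generic_shift:
  assumes "q_generic q I x"
  shows "q_generic q I (x(j := q * x j))"
proof -
  define d where "d i = (if i = j then 1 else 0 :: nat)" for i
  have "q ^ a * (x(j := q * x j)) i = q ^ (a + d i) * x i" for a i
    by (simp add: d_def)
  then show ?thesis
    using assms by (auto simp: q_generic_def)
qed

text \<open>An equality \<open>q\<^sup>a x\<^sub>j = q\<^sup>b x\<^sub>i\<close> forces \<open>i = j\<close> and then \<open>a = b\<close>.\<close>
lemma q_generic_neq:
  assumes "q_generic q I x" and "i \<in> I" and "j \<in> I" and "i = j \<Longrightarrow> a < b"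
  shows "q ^ a * x j \<noteq> q ^ b * x i"
proof (cases "i = j")
  case True
  then obtain d where "b = a + Suc d"
    using assms(4) less_iff_Suc_add by auto
  then show ?thesis
    using True q_genericD(1,3)[OF assms(1)] q_genericD(2)[OF assms(1), of d] assms(2)
    by (simp add: power_add)
next
  case False
  then show ?thesis
    using q_genericD(4)[OF assms(1), of j i a b] assms(2,3) by auto
qed

definition shift_product ::
  "'b::field \<Rightarrow> 'i set \<Rightarrow> ('i \<Rightarrow> 'b) \<Rightarrow> ('i \<Rightarrow> 'b) \<Rightarrow> ('i \<Rightarrow> nat) \<Rightarrow> 'b" where
  "shift_product q I A x \<beta> =
    (\<Prod>j\<in>I. \<Prod>m<\<beta> j. \<Prod>i\<in>I. (q ^ m * x j - A i) / (q ^ m * x j - q ^ \<beta> i * x i))"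

text \<open>
  Both multi-indices have the same endpoints \<open>q\<^bsup>\<beta>\<^sub>i\<^esup> x\<^sub>i\<close>, and the points of the two products
  differ only in \<open>x\<^sub>j\<close>, where the factor is a quotient of two residue weights.
\<close>
lemma residue_weight_shift:
  fixes A x :: "'i \<Rightarrow> 'b::field" and \<gamma> :: "'i \<Rightarrow> nat"
  assumes "finite I" and gen: "q_generic q I x" and j: "j \<in> I"
  defines "\<beta> \<equiv> \<gamma>(j := Suc (\<gamma> j))"
  shows "residue_weight I (\<lambda>i. q ^ \<beta> i * x i) x j * shift_product q I A x \<beta>
    = residue_weight I A x j * shift_product q I A (x(j := q * x j)) \<gamma>"
proof -
  define x' where "x' = x(j := q * x j)"
  define \<rho> where "\<rho> z = (\<Prod>i\<in>I. (z - A i) / (z - q ^ \<beta> i * x i))" for z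
  have "q ^ \<gamma> i * x' i = q ^ \<beta> i * x i" for i
    by (simp add: x'_def \<beta>_def)
  then have sp': "shift_product q I A x' \<gamma> = (\<Prod>l\<in>I. \<Prod>m<\<gamma> l. \<rho> (q ^ m * x' l))"
    by (simp add: shift_product_def \<rho>_def)
  have "shift_product q I A x \<beta> = (\<Prod>l\<in>I. \<Prod>m<\<beta> l. \<rho> (q ^ m * x l))"
    by (simp add: shift_product_def \<rho>_def)
  also have "\<dots> = (\<Prod>m<\<beta> j. \<rho> (q ^ m * x j)) * (\<Prod>l\<in>I - {j}. \<Prod>m<\<beta> l. \<rho> (q ^ m * x l))"
    using assms(1) j by (rule prod.remove)
  also have "(\<Prod>m<\<beta> j. \<rho> (q ^ m * x j)) = \<rho> (x j) * (\<Prod>m<\<gamma> j. \<rho> (q ^ m * x' j))"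
    by (simp add: \<beta>_def x'_def prod.lessThan_Suc_shift mult_ac del: prod.lessThan_Suc)
  also have "(\<Prod>l\<in>I - {j}. \<Prod>m<\<beta> l. \<rho> (q ^ m * x l))
      = (\<Prod>l\<in>I - {j}. \<Prod>m<\<gamma> l. \<rho> (q ^ m * x' l))"
    by (rule prod.cong) (auto simp: \<beta>_def x'_def)
  finally have sp: "shift_product q I A x \<beta> = \<rho> (x j) * shift_product q I A x' \<gamma>"
    unfolding sp' prod.remove[OF assms(1) j] by (simp add: mult.assoc)
  have "x j - q ^ \<beta> i * x i \<noteq> 0" if "i \<in> I" for i
    using q_generic_neq[OF gen that j, of 0 "\<beta> i"] by (simp add: \<beta>_def)
  then have "(\<Prod>i\<in>I. x j - q ^ \<beta> i * x i) \<noteq> 0"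
    using assms(1) by simp
  then have "residue_weight I (\<lambda>i. q ^ \<beta> i * x i) x j * \<rho> (x j) = residue_weight I A x j"
    unfolding residue_weight_def \<rho>_def prod_dividef by (simp add: field_simps)
  then show ?thesis
    unfolding sp x'_def[symmetric] by (simp add: mult.assoc[symmetric])
qed

definition multi_indices_of_size :: "'i set \<Rightarrow> nat \<Rightarrow> ('i \<Rightarrow> nat) set" where
  "multi_indices_of_size I k = {\<beta> \<in> I \<rightarrow>\<^sub>E UNIV. sum \<beta> I = k}"

lemma finite_multi_indices_of_size:
  assumes "finite I"
  shows "finite (multi_indices_of_size I k)"
proof (rule finite_subset)
  show "multi_indices_of_size I k \<subseteq> I \<rightarrow>\<^sub>E {..k}"
    using assms by (auto simp: multi_indices_of_size_def PiE_iff extensional_def intro!: member_le_sum)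
  show "finite (I \<rightarrow>\<^sub>E {..k})"
    using assms by (simp add: finite_PiE)
qed

lemma multi_indices_of_size_0: "finite I \<Longrightarrow> multi_indices_of_size I 0 = {\<lambda>i\<in>I. 0}"
  by (auto simp: multi_indices_of_size_def PiE_iff extensional_def restrict_def fun_eq_iff)

lemma bij_betw_increment:
  assumes "finite I" and "j \<in> I"
  shows "bij_betw (\<lambda>\<gamma>. \<gamma>(j := Suc (\<gamma> j))) (multi_indices_of_size I k)
    {\<beta> \<in> multi_indices_of_size I (Suc k). 0 < \<beta> j}"
proof (rule bij_betw_byWitness[where f' = "\<lambda>\<beta>. \<beta>(j := \<beta> j - 1)"])
  have sum: "sum (\<gamma>(j := v)) I = v + sum \<gamma> (I - {j})" for \<gamma> :: "'a \<Rightarrow> nat" and v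
    using assms by (simp add: sum.remove)
  have sum': "sum \<gamma> I = \<gamma> j + sum \<gamma> (I - {j})" for \<gamma> :: "'a \<Rightarrow> nat"
    using assms by (simp add: sum.remove)
  have ext: "\<gamma>(j := v) \<in> I \<rightarrow>\<^sub>E UNIV" if "\<gamma> \<in> I \<rightarrow>\<^sub>E UNIV" for \<gamma> :: "'a \<Rightarrow> nat" and v
    using that assms(2) by (auto simp: PiE_iff extensional_def)
  show "(\<lambda>\<gamma>. \<gamma>(j := Suc (\<gamma> j))) ` multi_indices_of_size I k
      \<subseteq> {\<beta> \<in> multi_indices_of_size I (Suc k). 0 < \<beta> j}"
    using ext by (auto simp: multi_indices_of_size_def sum sum')
  show "(\<lambda>\<beta>. \<beta>(j := \<beta> j - 1)) ` {\<beta> \<in> multi_indices_of_size I (Suc k). 0 < \<beta> j}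
      \<subseteq> multi_indices_of_size I k"
    using ext by (auto simp: multi_indices_of_size_def sum sum')
qed auto

text \<open>
  Multiplying by \<open>1 - q\<^bsup>k+1\<^esup>\<close> inserts the sum of the residue weights of the endpoints
  \<open>q\<^bsup>\<beta>\<^sub>i\<^esup> x\<^sub>i\<close>.  Such a weight vanishes if \<open>\<beta>\<^sub>j = 0\<close>, so the multi-indices that remain are the
  increments at \<open>j\<close> of those of size \<open>k\<close>.
\<close>
theorem sum_shift_product:
  fixes A x :: "'i \<Rightarrow> 'b::field"
  assumes fin: "finite I" and "q_generic q I x"
  shows "(\<Sum>\<beta>\<in>multi_indices_of_size I k. shift_product q I A x \<beta>)
    = qbinom q (prod A I / prod x I) k"
  using assms(2)
proof (induction k arbitrary: x)
  case 0
  show ?case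
    using fin by (simp add: multi_indices_of_size_0 shift_product_def)
next
  case (Suc k)
  note gen = Suc.prems
  let ?S = "multi_indices_of_size I"
  let ?Q = "prod A I / prod x I"
  let ?w = "\<lambda>\<beta>. residue_weight I (\<lambda>i. q ^ \<beta> i * x i) x"
  have total: "(\<Sum>j\<in>I. residue_weight I A' x j) = 1 - prod A' I / prod x I" for A'
    using fin q_generic_inj_on[OF gen] q_genericD(3)[OF gen] by (rule sum_residue_weight)
  have nz: "prod x I \<noteq> 0"
    using fin q_genericD(3)[OF gen] by simp
  have w_sum: "(\<Sum>j\<in>I. ?w \<beta> j) = 1 - q ^ Suc k" if "\<beta> \<in> ?S (Suc k)" for \<beta>
    using that nz by (simp add: total prod.distrib power_sum[symmetric] multi_indices_of_size_def)
  have w_0: "?w \<beta> j = 0" if "j \<in> I" "\<beta> j = 0" for \<beta> j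
    unfolding residue_weight_def using fin that by (auto intro!: bexI[of _ j])
  have inner: "(\<Sum>\<beta>\<in>?S (Suc k). ?w \<beta> j * shift_product q I A x \<beta>)
      = residue_weight I A x j * qbinom q (?Q / q) k" if j: "j \<in> I" for j
  proof -
    let ?x' = "x(j := q * x j)"
    have "(\<Sum>\<beta>\<in>?S (Suc k). ?w \<beta> j * shift_product q I A x \<beta>)
        = (\<Sum>\<beta>\<in>{\<beta> \<in> ?S (Suc k). 0 < \<beta> j}. ?w \<beta> j * shift_product q I A x \<beta>)"
      using w_0[OF j] finite_multi_indices_of_size[OF fin]
      by (intro sum.mono_neutral_right) auto
    also have "\<dots> = (\<Sum>\<gamma>\<in>?S k. residue_weight I A x j * shift_product q I A ?x' \<gamma>)"
      unfolding sum.reindex_bij_betw[OF bij_betw_increment[OF fin j], symmetric]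
        residue_weight_shift[OF fin gen j] ..
    also have "\<dots> = residue_weight I A x j * qbinom q (prod A I / prod ?x' I) k"
      unfolding sum_distrib_left[symmetric] Suc.IH[OF q_generic_shift[OF gen]] ..
    also have "prod ?x' I = q * prod x I"
      using fin j by (simp add: prod.remove mult.assoc)
    finally show ?thesis
      by (simp add: mult.commute)
  qed
  have "(1 - q ^ Suc k) * (\<Sum>\<beta>\<in>?S (Suc k). shift_product q I A x \<beta>)
      = (\<Sum>\<beta>\<in>?S (Suc k). \<Sum>j\<in>I. ?w \<beta> j * shift_product q I A x \<beta>)"
    by (simp add: sum_distrib_left sum_distrib_right[symmetric] w_sum)
  also have "\<dots> = (\<Sum>j\<in>I. residue_weight I A x j * qbinom q (?Q / q) k)"
    by (subst sum.swap) (simp add: inner)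
  also have "\<dots> = (1 - q ^ Suc k) * qbinom q ?Q (Suc k)"
    unfolding sum_distrib_right[symmetric] total
    by (rule qbinom_absorption[OF q_genericD(1,2)[OF gen], symmetric])
  finally show ?case
    using q_genericD(2)[OF gen, of k] by simp
qed

section \<open>The coefficients as shift products\<close>

text \<open>
  The reversal \<open>m \<mapsto> b - 1 - m\<close> makes all exponents nonnegative after clearing denominators, and
  the resulting denominators depend on neither \<open>a\<close> nor \<open>z\<close>, so they cancel in \<open>C\<^sub>\<alpha>\<^sub>,\<^sub>\<beta>\<close>.
\<close>
lemma qpoch_reversed:
  fixes q y :: "'b::field"
  assumes "q \<noteq> 0" and "y \<noteq> 0"
  shows "qpoch (q powi (int a - int b + 1) * z / y) q b
    = (\<Prod>m<b. (q ^ m * y - q ^ a * z) / (q ^ m * y))"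
proof -
  have "qpoch (q powi (int a - int b + 1) * z / y) q b
      = (\<Prod>m<b. 1 - q powi (int a - int b + 1) * z / y * q ^ (b - Suc m))"
    unfolding qpoch_def by (rule prod.nat_diff_reindex[symmetric])
  also have "\<dots> = (\<Prod>m<b. (q ^ m * y - q ^ a * z) / (q ^ m * y))"
  proof (rule prod.cong)
    fix m assume "m \<in> {..<b}"
    then have "int a - int b + 1 + int (b - Suc m) = int a - int m"
      by auto
    then have "q powi (int a - int b + 1) * q ^ (b - Suc m) = q ^ a / q ^ m"
      using assms(1) by (metis power_int_add power_int_diff power_int_of_nat)
    moreover have "q powi (int a - int b + 1) * z / y * q ^ (b - Suc m)
        = q powi (int a - int b + 1) * q ^ (b - Suc m) * z / y"
      by simp
    ultimately have "q powi (int a - int b + 1) * z / y * q ^ (b - Suc m) = q ^ a / q ^ m * z / y"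
      by (simp only:)
    then show "1 - q powi (int a - int b + 1) * z / y * q ^ (b - Suc m)
        = (q ^ m * y - q ^ a * z) / (q ^ m * y)"
      using assms by (simp only:) (simp add: diff_divide_distrib)
  qed simp
  finally show ?thesis .
qed

lemma C_coeff_eq_shift_product:
  assumes gen: "q_generic q {1..n} x"
  shows "C_coeff n \<alpha> \<beta> x q = shift_product q {1..n} (\<lambda>i. q ^ \<alpha> i * x i) x \<beta>"
proof -
  have "C_coeff n \<alpha> \<beta> x q = (\<Prod>i\<in>{1..n}. \<Prod>j\<in>{1..n}. \<Prod>m<\<beta> j.
      (q ^ m * x j - q ^ \<alpha> i * x i) / (q ^ m * x j - q ^ \<beta> i * x i))"
    unfolding C_coeff_def using q_genericD(1,3)[OF gen]
    by (intro prod.cong refl) (simp add: qpoch_reversed prod_dividef[symmetric])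
  also have "\<dots> = (\<Prod>j\<in>{1..n}. \<Prod>i\<in>{1..n}. \<Prod>m<\<beta> j.
      (q ^ m * x j - q ^ \<alpha> i * x i) / (q ^ m * x j - q ^ \<beta> i * x i))"
    by (rule prod.swap)
  also have "\<dots> = shift_product q {1..n} (\<lambda>i. q ^ \<alpha> i * x i) x \<beta>"
    unfolding shift_product_def by (intro prod.cong[OF refl] prod.swap)
  finally show ?thesis .
qed

text \<open>If \<open>\<alpha>\<^sub>j < \<beta>\<^sub>j\<close>, the point \<open>q\<^bsup>\<alpha>\<^sub>j\<^esup> x\<^sub>j\<close> is among those of the product and is a zero of it.\<close>
lemma shift_product_eq_0:
  assumes "finite I" and "j \<in> I" and "\<alpha> j < \<beta> j"
  shows "shift_product q I (\<lambda>i. q ^ \<alpha> i * x i) x \<beta> = 0"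
proof -
  have "(\<Prod>i\<in>I. (q ^ \<alpha> j * x j - q ^ \<alpha> i * x i) / (q ^ \<alpha> j * x j - q ^ \<beta> i * x i)) = 0"
    using assms by (intro prod_zero) (auto intro!: bexI[of _ j])
  then have "(\<Prod>m<\<beta> j. \<Prod>i\<in>I.
      (q ^ m * x j - q ^ \<alpha> i * x i) / (q ^ m * x j - q ^ \<beta> i * x i)) = 0"
    using assms by (intro prod_zero) (auto intro!: bexI[of _ "\<alpha> j"])
  then show ?thesis
    unfolding shift_product_def using assms by (intro prod_zero) (auto intro!: bexI[of _ j])
qed

text \<open>
  The shift products of the multi-indices \<open>\<beta>\<close> with \<open>\<beta> \<not>\<le> \<alpha>\<close> vanish, so the restriction to
  \<open>\<beta> \<le> \<alpha>\<close> may be dropped and the evaluation above applies with \<open>Q = q\<^bsup>|\<alpha>|\<^esup>\<close>.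
\<close>
lemma sum_C_coeff:
  assumes gen: "q_generic q {1..n} x"
  shows "(\<Sum>\<beta> | \<beta> \<in> multi_index n \<and> mi_le n \<beta> \<alpha> \<and> mi_abs n \<beta> = k. C_coeff n \<alpha> \<beta> x q)
    = qbinom q (q ^ mi_abs n \<alpha>) k"
proof -
  let ?A = "\<lambda>i. q ^ \<alpha> i * x i"
  have nz: "prod x {1..n} \<noteq> 0"
    using q_genericD(3)[OF gen] by simp
  have "(\<Sum>\<beta> | \<beta> \<in> multi_index n \<and> mi_le n \<beta> \<alpha> \<and> mi_abs n \<beta> = k. C_coeff n \<alpha> \<beta> x q)
      = (\<Sum>\<beta>\<in>multi_indices_of_size {1..n} k. shift_product q {1..n} ?A x \<beta>)"
    unfolding C_coeff_eq_shift_product[OF gen]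
  proof (rule sum.mono_neutral_left)
    show "finite (multi_indices_of_size {1..n} k)"
      by (rule finite_multi_indices_of_size) simp
    show "{\<beta>. \<beta> \<in> multi_index n \<and> mi_le n \<beta> \<alpha> \<and> mi_abs n \<beta> = k}
        \<subseteq> multi_indices_of_size {1..n} k"
      by (auto simp: multi_indices_of_size_def multi_index_def mi_abs_def)
    show "\<forall>\<beta>\<in>multi_indices_of_size {1..n} k
        - {\<beta>. \<beta> \<in> multi_index n \<and> mi_le n \<beta> \<alpha> \<and> mi_abs n \<beta> = k}.
        shift_product q {1..n} ?A x \<beta> = 0"
    proof
      fix \<beta> assume "\<beta> \<in> multi_indices_of_size {1..n} k
        - {\<beta>. \<beta> \<in> multi_index n \<and> mi_le n \<beta> \<alpha> \<and> mi_abs n \<beta> = k}"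
      then have "\<not> mi_le n \<beta> \<alpha>"
        by (auto simp: multi_indices_of_size_def multi_index_def mi_abs_def)
      then obtain j where "j \<in> {1..n}" "\<alpha> j < \<beta> j"
        by (auto simp: mi_le_def not_le)
      then show "shift_product q {1..n} ?A x \<beta> = 0"
        by (intro shift_product_eq_0) auto
    qed
  qed
  also have "\<dots> = qbinom q (prod ?A {1..n} / prod x {1..n}) k"
    using gen by (intro sum_shift_product) simp
  also have "prod ?A {1..n} / prod x {1..n} = q ^ mi_abs n \<alpha>"
    using nz by (simp add: prod.distrib power_sum mi_abs_def)
  finally show ?thesis .
qed

theorem multivariate_q_binomial:
  fixes q u :: "'b::field"
  assumes gen: "q_generic q {1..n} x"
  shows "(\<Sum>\<beta> \<in> {\<beta> \<in> multi_index n. mi_le n \<beta> \<alpha>}.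
      (- 1) ^ mi_abs n \<beta> * q ^ (mi_abs n \<beta> choose 2) * C_coeff n \<alpha> \<beta> x q * u ^ mi_abs n \<beta>)
    = qpoch u q (mi_abs n \<alpha>)"
proof -
  let ?M = "{\<beta> \<in> multi_index n. mi_le n \<beta> \<alpha>}"
  let ?N = "mi_abs n \<alpha>"
  let ?h = "\<lambda>\<beta>. (- 1) ^ mi_abs n \<beta> * q ^ (mi_abs n \<beta> choose 2)
    * C_coeff n \<alpha> \<beta> x q * u ^ mi_abs n \<beta>"
  have "?M \<subseteq> (\<Pi>\<^sub>E i\<in>{1..n}. {..\<alpha> i})"
    by (auto simp: multi_index_def mi_le_def PiE_iff extensional_def)
  then have fin: "finite ?M"
    by (rule finite_subset) (simp add: finite_PiE)
  have range: "mi_abs n ` ?M \<subseteq> {..?N}"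
    by (auto simp: mi_abs_def mi_le_def intro: sum_mono)
  have "sum ?h ?M = (\<Sum>k\<le>?N. sum ?h {\<beta> \<in> ?M. mi_abs n \<beta> = k})"
    by (rule sum.group[OF fin finite_atMost range, symmetric])
  also have "\<dots> = (\<Sum>k\<le>?N. (- 1) ^ k * q ^ (k choose 2) * qbinom q (q ^ ?N) k * u ^ k)"
  proof (rule sum.cong[OF refl])
    fix k
    have "sum ?h {\<beta> \<in> ?M. mi_abs n \<beta> = k}
        = (\<Sum>\<beta> | \<beta> \<in> multi_index n \<and> mi_le n \<beta> \<alpha> \<and> mi_abs n \<beta> = k.
            (- 1) ^ k * q ^ (k choose 2) * C_coeff n \<alpha> \<beta> x q * u ^ k)"
      by (rule sum.cong) auto
    then show "sum ?h {\<beta> \<in> ?M. mi_abs n \<beta> = k}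
        = (- 1) ^ k * q ^ (k choose 2) * qbinom q (q ^ ?N) k * u ^ k"
      by (simp only: sum_distrib_left[symmetric] sum_distrib_right[symmetric] sum_C_coeff[OF gen])
  qed
  also have "\<dots> = qpoch u q ?N"
    by (rule q_binomial_theorem[OF q_genericD(1,2)[OF gen]])
  finally show ?thesis .
qed

section \<open>Indeterminates are generic\<close>

definition monomial :: "(nat \<Rightarrow>\<^sub>0 nat) \<Rightarrow> 'a::field ratfun" where
  "monomial s = Fract (Poly_Mapping.single s 1) 1"

lemma monomial_0: "monomial 0 = 1"
  by (simp add: monomial_def One_fract_def)

lemma monomial_add: "monomial (s + t) = monomial s * monomial t"
  by (simp add: monomial_def mult_single)

lemma monomial_eq_iff: "monomial s = (monomial t :: 'a::field ratfun) \<longleftrightarrow> s = t"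
proof
  assume "monomial s = (monomial t :: 'a ratfun)"
  then have "Poly_Mapping.single s 1 = (Poly_Mapping.single t 1 :: (nat \<Rightarrow>\<^sub>0 nat) \<Rightarrow>\<^sub>0 'a)"
    by (simp add: monomial_def eq_fract)
  then have "Poly_Mapping.keys (Poly_Mapping.single s (1 :: 'a))
      = Poly_Mapping.keys (Poly_Mapping.single t (1 :: 'a))"
    by simp
  then show "s = t" by simp
qed simp

lemma monomial_nonzero: "monomial s \<noteq> (0 :: 'a::field ratfun)"
proof
  assume "monomial s = (0 :: 'a ratfun)"
  then have "Poly_Mapping.single s 1 = (0 :: (nat \<Rightarrow>\<^sub>0 nat) \<Rightarrow>\<^sub>0 'a)"
    by (simp add: monomial_def Zero_fract_def eq_fract)
  then have "Poly_Mapping.keys (Poly_Mapping.single s (1 :: 'a)) = {}"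
    by simp
  then show False by simp
qed

lemma indet_eq_monomial: "indet v = monomial (Poly_Mapping.single v 1)"
  by (simp add: indet_def monomial_def)

lemma indet_power: "indet v ^ k = (monomial (Poly_Mapping.single v k) :: 'a::field ratfun)"
proof (induction k)
  case 0
  show ?case by (simp add: monomial_0)
next
  case (Suc k)
  have "(indet v :: 'a ratfun) ^ Suc k
      = monomial (Poly_Mapping.single v 1) * monomial (Poly_Mapping.single v k)"
    by (simp only: power_Suc Suc) (simp only: indet_eq_monomial)
  also have "\<dots> = monomial (Poly_Mapping.single v (Suc k))"
    by (simp add: monomial_add[symmetric] single_add[symmetric])
  finally show ?case .
qed

text \<open>
  Both sides of every inequality between powers and shifted variables are monomials, so it
  suffices to tell their exponent vectors apart.
\<close>
lemma q_generic_indeterminates: "q_generic q_var I (x_var :: nat \<Rightarrow> 'a::field ratfun)"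
  unfolding q_generic_def
proof (intro conjI allI ballI impI)
  show "q_var \<noteq> (0 :: 'a ratfun)"
    by (simp add: q_var_def indet_eq_monomial monomial_nonzero)
  show "x_var i \<noteq> (0 :: 'a ratfun)" for i
    by (simp add: x_var_def indet_eq_monomial monomial_nonzero)
  show "q_var ^ Suc k \<noteq> (1 :: 'a ratfun)" for k
  proof
    assume "q_var ^ Suc k = (1 :: 'a ratfun)"
    then have "Poly_Mapping.single 0 (Suc k) = (0 :: nat \<Rightarrow>\<^sub>0 nat)"
      unfolding q_var_def indet_power monomial_0[symmetric] monomial_eq_iff .
    then have "Poly_Mapping.keys (Poly_Mapping.single (0::nat) (Suc k)) = {}"
      by (metis keys_zero)
    then show False by simp
  qed
  show "q_var ^ a * x_var i \<noteq> (q_var ^ b * x_var j :: 'a ratfun)" if "i \<noteq> j" for i j a b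
  proof
    assume "q_var ^ a * x_var i = (q_var ^ b * x_var j :: 'a ratfun)"
    then have "Poly_Mapping.single 0 a + Poly_Mapping.single (i + 2) (1::nat)
        = Poly_Mapping.single 0 b + Poly_Mapping.single (j + 2) 1"
      unfolding q_var_def x_var_def indet_power
      unfolding indet_eq_monomial monomial_add[symmetric] monomial_eq_iff .
    then have "Poly_Mapping.lookup
          (Poly_Mapping.single 0 a + Poly_Mapping.single (i + 2) (1::nat)) (i + 2)
        = Poly_Mapping.lookup (Poly_Mapping.single 0 b + Poly_Mapping.single (j + 2) 1) (i + 2)"
      by simp
    then show False
      using that by (simp add: lookup_add lookup_single)
  qed
qed

theorem theorem1p3:
  fixes n :: nat and \<alpha> :: "nat \<Rightarrow> nat"
  assumes "n \<ge> 1" and "\<alpha> \<in> multi_index n"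
  shows "(\<Sum>\<beta> \<in> {\<beta> \<in> multi_index n. mi_le n \<beta> \<alpha>}.
            (- 1) ^ mi_abs n \<beta> * q_var ^ (mi_abs n \<beta> choose 2)
              * C_coeff n \<alpha> \<beta> x_var q_var * u_var ^ mi_abs n \<beta>)
         = (qpoch u_var q_var (mi_abs n \<alpha>) :: 'a::field ratfun)"
  by (rule multivariate_q_binomial[OF q_generic_indeterminates])

end
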